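(* Let $\lambda_0\ge 1$ be an integer, $\alpha\ge 1$ a real number, and $\lambda_k=\lceil\lambda_0(k+1)^\alpha\rceil$ for $k\ge 0$. Let $\mathcal{L}^\#(\hat\lambda,\alpha)$ be the loss function of this restart strategy, and let $$\mathcal{L}^\#_{\mathrm{up}}(\hat\lambda,\alpha)=\frac{\lambda_0}{\alpha+1}\left(\sqrt[\alpha]{\frac{\hat\lambda-1}{\lambda_0}}+2\right)^{\alpha+1}+\sqrt[\alpha]{\frac{\hat\lambda-1}{\lambda_0}}-\frac{\lambda_0}{\alpha+1}.$$ Then $\mathcal{L}^\#_{\mathrm{up}}(\hat\lambda,\alpha)$ is an upper bound of $\mathcal{L}^\#(\hat\lambda,\alpha)$, i.e. $\mathcal{L}^\#(\hat\lambda,\alpha)\le\mathcal{L}^\#_{\mathrm{up}}(\hat\lambda,\alpha)$ for all integers $\hat\lambda\ge\lambda_0$.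
   Context: For a restart strategy $(\lambda_0,\lambda_1,\lambda_2,\ldots)$ (an unbounded sequence of natural numbers) and an integer $\hat\lambda\ge\lambda_0$, let $\hat k(\hat\lambda)=\min\{k\ge 0:\lambda_k\ge\hat\lambda\}$. The loss function is $\mathcal{L}(\hat\lambda)=\sum_{k=0}^{\hat k(\hat\lambda)}\lambda_k-\hat\lambda$; it is denoted $\mathcal{L}^\#(\hat\lambda,\alpha)$ for the strategy $\lambda_k=\lceil\lambda_0(k+1)^\alpha\rceil$. Here $\sqrt[\alpha]{x}=x^{1/\alpha}$ for real $x\ge 0$. *)

theory Defs
  imports Complex_Main
begin

definition restart_strategy :: "(nat \<Rightarrow> nat) \<Rightarrow> bool" where
  "restart_strategy lam \<longleftrightarrow> \<not> bdd_above (range lam)"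

(* The minimum exists for every restart strategy, as the sequence is unbounded. *)
definition khat :: "(nat \<Rightarrow> nat) \<Rightarrow> nat \<Rightarrow> nat" where
  "khat lam lhat = (LEAST k. lam k \<ge> lhat)"

(* Integer-valued, so that the subtraction is not truncated. *)
definition loss :: "(nat \<Rightarrow> nat) \<Rightarrow> nat \<Rightarrow> int" where
  "loss lam lhat = (\<Sum>k = 0..khat lam lhat. int (lam k)) - int lhat"

(* The argument of the ceiling is nonnegative, so nat does not truncate. *)
definition power_strategy :: "nat \<Rightarrow> real \<Rightarrow> nat \<Rightarrow> nat" where
  "power_strategy l0 \<alpha> k = nat \<lceil>real l0 * (real k + 1) powr \<alpha>\<rceil>"

definition loss_power :: "nat \<Rightarrow> nat \<Rightarrow> real \<Rightarrow> int" where
  "loss_power l0 lhat \<alpha> = loss (power_strategy l0 \<alpha>) lhat"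

(* The root of real index; root in the library takes a natural index.
   For a > 0 it also gives the value 0 at x = 0. *)
definition real_root :: "real \<Rightarrow> real \<Rightarrow> real" where
  "real_root a x = x powr (1 / a)"

definition loss_power_up :: "nat \<Rightarrow> nat \<Rightarrow> real \<Rightarrow> real" where
  "loss_power_up l0 lhat \<alpha> =
     real l0 / (\<alpha> + 1) * (real_root \<alpha> ((real lhat - 1) / real l0) + 2) powr (\<alpha> + 1)
     + real_root \<alpha> ((real lhat - 1) / real l0)
     - real l0 / (\<alpha> + 1)"

lemma power_strategy_0: "power_strategy l0 \<alpha> 0 = l0"
  by (simp add: power_strategy_def)

lemma restart_strategy_power_strategy:
  assumes "l0 \<ge> 1" and "\<alpha> \<ge> 1"
  shows "restart_strategy (power_strategy l0 \<alpha>)"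
  unfolding restart_strategy_def
proof
  assume "bdd_above (range (power_strategy l0 \<alpha>))"
  then obtain B where B: "power_strategy l0 \<alpha> k \<le> B" for k
    by (auto simp: bdd_above_def)
  have "real B + 1 \<le> (real B + 1) powr \<alpha>"
    using powr_mono[of 1 \<alpha> "real B + 1"] assms by simp
  also have "\<dots> \<le> real l0 * (real B + 1) powr \<alpha>"
    using assms mult_right_mono[of 1 "real l0" "(real B + 1) powr \<alpha>"] by simp
  also have "\<dots> \<le> real (power_strategy l0 \<alpha> B)"
    unfolding power_strategy_def by (rule of_nat_ceiling)
  also have "\<dots> \<le> real B"
    using B by simp
  finally show False by simp
qed

end

theory Submission
  imports Defs
begin

text \<open>
  Write \<open>K\<close> for the index at which the strategy first reaches \<open>lhat\<close>, and \<open>r\<close> for the root in the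
  bound. Minimality of \<open>K\<close> and integrality give \<open>l0 * K powr \<alpha> \<le> lhat - 1\<close>, that is, \<open>K \<le> r\<close>.
  The term for \<open>k = 0\<close> is not rounded and each of the other \<open>K\<close> terms is rounded up by at most \<open>1\<close>;
  comparing the power sum with the integral of \<open>x powr \<alpha>\<close> over \<open>[1, K + 2]\<close> bounds the total by
  \<open>K + l0 * ((K + 2) powr (\<alpha> + 1) - 1) / (\<alpha> + 1)\<close>, which is increasing in \<open>K\<close>.
\<close>

text \<open>By the mean value theorem the right side is \<open>(a + 1) * z powr a\<close> for some
  \<open>z\<close> between \<open>x\<close> and \<open>x + 1\<close>. This is the integral
  comparison on one unit interval.\<close>

lemma powr_diff_ge:
  fixes x a :: real
  assumes "x > 0" "a \<ge> 0"
  shows "(a + 1) * x powr a \<le> (x + 1) powr (a + 1) - x powr (a + 1)"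
proof -
  have "((\<lambda>y. y powr (a + 1)) has_real_derivative (a + 1) * y powr a) (at y)" if "x \<le> y" for y
    using has_real_derivative_powr[of y "a + 1"] that assms by simp
  then obtain z where z: "x < z" "z < x + 1"
    and eq: "(x + 1) powr (a + 1) - x powr (a + 1) = (x + 1 - x) * ((a + 1) * z powr a)"
    using MVT2[of x "x + 1" "\<lambda>y. y powr (a + 1)" "\<lambda>y. (a + 1) * y powr a"] by auto
  have "x powr a \<le> z powr a"
    using z assms by (intro powr_mono2) auto
  then show ?thesis
    using eq assms by (simp add: mult_left_mono)
qed

text \<open>The bounds from \<open>powr_diff_ge\<close> telescope; the \<open>- 1\<close> is the
  value of the power at the lower end 1.\<close>

lemma sum_powr_le:
  fixes a :: real
  assumes "a \<ge> 0"
  shows "(\<Sum>k<n. (real k + 1) powr a) \<le> ((real n + 1) powr (a + 1) - 1) / (a + 1)"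
proof (induction n)
  case 0
  show ?case by simp
next
  case (Suc n)
  have "(a + 1) * (real n + 1) powr a \<le> (real n + 1 + 1) powr (a + 1) - (real n + 1) powr (a + 1)"
    using assms by (intro powr_diff_ge) auto
  then have "(real n + 1) powr a
      \<le> ((real n + 1 + 1) powr (a + 1) - (real n + 1) powr (a + 1)) / (a + 1)"
    using assms by (simp add: pos_le_divide_eq mult.commute)
  with Suc show ?case
    by (simp add: diff_divide_distrib add_ac)
qed

lemma power_strategy_le: "real (power_strategy l0 \<alpha> k) \<le> real l0 * (real k + 1) powr \<alpha> + 1"
  unfolding power_strategy_def by simp

lemma sum_power_strategy_le:
  assumes "\<alpha> \<ge> 0"
  shows "(\<Sum>k\<le>n. real (power_strategy l0 \<alpha> k))
    \<le> real n + real l0 * (((real n + 2) powr (\<alpha> + 1) - 1) / (\<alpha> + 1))"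
proof -
  have "(\<Sum>k\<le>n. real (power_strategy l0 \<alpha> k))
      \<le> real n + real l0 * (\<Sum>k<Suc n. (real k + 1) powr \<alpha>)"
  proof (induction n)
    case 0
    show ?case by (simp add: power_strategy_0)
  next
    case (Suc n)
    then show ?case
      using power_strategy_le[of l0 \<alpha> "Suc n"] by (simp add: algebra_simps)
  qed
  also have "\<dots> \<le> real n + real l0 * (((real n + 2) powr (\<alpha> + 1) - 1) / (\<alpha> + 1))"
    using sum_powr_le[OF assms, of "Suc n"]
    by (intro add_left_mono mult_left_mono) (simp_all add: add_ac)
  finally show ?thesis .
qed

lemma khat_power_strategy_le:
  assumes "l0 \<ge> 1" "\<alpha> > 0"
  shows "real (khat (power_strategy l0 \<alpha>) lhat) \<le> real_root \<alpha> ((real lhat - 1) / real l0)"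
proof (cases "khat (power_strategy l0 \<alpha>) lhat")
  case 0
  \<comment> \<open>A value of \<open>powr\<close> is never negative, even at
    \<open>lhat = 0\<close>, where the base is negative.\<close>
  then show ?thesis by (simp add: real_root_def)
next
  case (Suc m)
  then have "\<not> lhat \<le> power_strategy l0 \<alpha> m"
    unfolding khat_def by (intro not_less_Least) simp
  then have "real (power_strategy l0 \<alpha> m) \<le> real lhat - 1"
    by linarith
  \<comment> \<open>The shift in the strategy makes the base at the preceding index \<open>m\<close>
    equal to \<open>m + 1\<close>, the first reaching index itself.\<close>
  moreover have "real l0 * (real m + 1) powr \<alpha> \<le> real (power_strategy l0 \<alpha> m)"
    unfolding power_strategy_def by (rule of_nat_ceiling)
  ultimately have "(real m + 1) powr \<alpha> \<le> (real lhat - 1) / real l0"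
    using assms by (simp add: pos_le_divide_eq mult.commute)
  then have "((real m + 1) powr \<alpha>) powr (1 / \<alpha>) \<le> ((real lhat - 1) / real l0) powr (1 / \<alpha>)"
    using assms by (intro powr_mono2) auto
  then show ?thesis
    using assms Suc by (simp add: real_root_def powr_powr add_ac)
qed

theorem theorem7:
  fixes l0 :: nat and \<alpha> :: real
  assumes "l0 \<ge> 1" and "\<alpha> \<ge> 1"
  shows "\<forall>lhat \<ge> l0. real_of_int (loss_power l0 lhat \<alpha>) \<le> loss_power_up l0 lhat \<alpha>"
proof (intro allI impI)
  fix lhat
  define K where "K = khat (power_strategy l0 \<alpha>) lhat"
  define r where "r = real_root \<alpha> ((real lhat - 1) / real l0)"
  have Kr: "real K \<le> r"
    unfolding K_def r_def using assms by (intro khat_power_strategy_le) auto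
  \<comment> \<open>The subtracted \<open>lhat\<close> is dropped, so the bound even holds for the
    whole sum up to \<open>K\<close>.\<close>
  have "real_of_int (loss_power l0 lhat \<alpha>) \<le> (\<Sum>k\<le>K. real (power_strategy l0 \<alpha> k))"
    by (simp add: loss_power_def loss_def K_def atLeast0AtMost)
  also have "\<dots> \<le> real K + real l0 * (((real K + 2) powr (\<alpha> + 1) - 1) / (\<alpha> + 1))"
    using assms by (intro sum_power_strategy_le) auto
  also have "\<dots> \<le> r + real l0 * (((r + 2) powr (\<alpha> + 1) - 1) / (\<alpha> + 1))"
    using Kr assms
    by (intro add_mono mult_left_mono divide_right_mono diff_right_mono powr_mono2) auto
  also have "\<dots> = loss_power_up l0 lhat \<alpha>"
    by (simp add: loss_power_up_def r_def diff_divide_distrib right_diff_distrib)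
  finally show "real_of_int (loss_power l0 lhat \<alpha>) \<le> loss_power_up l0 lhat \<alpha>" .
qed

end
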